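(* Let $\alpha,\beta$ be parameters, $n\ge1$, $x_1,\dots,x_n$ variables and $\lambda$ a partition. Then $g^{(\alpha,\beta)}_\lambda(x_1,\dots,x_n)$ equals the partition function of the following lattice model: $n$ rows with bosonic horizontal labels (nonnegative integers), row $k$ (from the bottom) having parameter $x_k$, bottom boundary all $0$, top boundary $(m^c_j(\lambda))_{j\ge1}$, right boundary value $0$, free left boundary, and vertex weights $$w_x(a,b;c,d)=\delta_{a+b,c+d}\begin{cases}\beta(\alpha+\beta)^{a-d-1}(x+\alpha)^{d}& a>0,\ a>d,\\ x(x+\alpha)^{a-1}& 0<a\le d,\\ 1& a=0.\end{cases}$$
   Context: Dual canonical Grothendieck polynomials. For $\mu\subseteq\lambda$ let $r(\lambda/\mu)$, $c(\lambda/\mu)$, $b(\lambda/\mu)$ be the numbers of nonempty rows, nonempty columns and edge-connected components of $\lambda/\mu$. The $g^{(\alpha,\beta)}_\lambda$ are determined by $g^{(\alpha,\beta)}_\lambda()=\delta_{\lambda,\emptyset}$ (no variables) and $g^{(\alpha,\beta)}_\lambda(x_1,\dots,x_{n+1})=\sum_{\mu\subseteq\lambda}g^{(\alpha,\beta)}_\mu(x_1,\dots,x_n)g^{(\alpha,\beta)}_{\lambda/\mu}(x_{n+1})$, $g^{(\alpha,\beta)}_{\lambda/\mu}(x)=\beta^{r-b}(\alpha+\beta)^{|\lambda|-|\mu|-r-c+b}x^{b}(\alpha+x)^{c-b}$ with $r,c,b$ evaluated on $\lambda/\mu$. Lattice conventions. A vertex has left label $a$, bottom label $b$, right label $c$,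 top label $d$. A row with parameter $x$ is a sequence of vertices at sites $j=1,2,\dots$, the right label at site $j$ being the left label at site $j+1$; vertical labels are nonnegative integers; the left label at site 1 is free (summed over all values) and the right labels must be eventually equal to the prescribed right boundary value. Rows $1,\dots,n$ are stacked bottom to top, top labels of row $k$ = bottom labels of row $k+1$; bottom labels of row 1 and top labels of row $n$ are prescribed. The partition function is the sum over all labelings of non-prescribed edges of the product of vertex weights. $m^c_j(\lambda)=\lambda_j-\lambda_{j+1}$. *)

theory Defs
  imports Main
begin

text \<open>
  All indices are 0-based: \<open>lam i\<close> is the part \<open>\<lambda>\<^bsub>i+1\<^esub>\<close>, \<open>x k\<close> is the variable
  \<open>x\<^bsub>k+1\<^esub>\<close>, and site \<open>j\<close> and row \<open>k\<close> of a lattice are site \<open>j+1\<close> and row \<open>k+1\<close> of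
  the informal description. Partitions are infinite sequences padded by zeros, so that \<open>\<mu> \<subseteq> \<lambda>\<close> is
  the pointwise order on functions.
\<close>

definition is_partition :: "(nat \<Rightarrow> nat) \<Rightarrow> bool" where
  "is_partition lam \<longleftrightarrow> antimono lam \<and> finite {i. lam i \<noteq> 0}"

definition partition_size :: "(nat \<Rightarrow> nat) \<Rightarrow> nat" where
  "partition_size lam = (\<Sum>i | lam i \<noteq> 0. lam i)"

definition skew_diagram :: "(nat \<Rightarrow> nat) \<Rightarrow> (nat \<Rightarrow> nat) \<Rightarrow> (nat \<times> nat) set" where
  "skew_diagram lam mu = {(i, j). mu i \<le> j \<and> j < lam i}"

definition edge_adjacent :: "nat \<times> nat \<Rightarrow> nat \<times> nat \<Rightarrow> bool" where
  "edge_adjacent p q \<longleftrightarrow>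
     fst p = fst q \<and> (snd q = Suc (snd p) \<or> snd p = Suc (snd q)) \<or>
     snd p = snd q \<and> (fst q = Suc (fst p) \<or> fst p = Suc (fst q))"

definition num_rows :: "(nat \<times> nat) set \<Rightarrow> nat" where
  "num_rows S = card (fst ` S)"

definition num_cols :: "(nat \<times> nat) set \<Rightarrow> nat" where
  "num_cols S = card (snd ` S)"

definition num_components :: "(nat \<times> nat) set \<Rightarrow> nat" where
  "num_components S = card (S // {(p, q). p \<in> S \<and> q \<in> S \<and> edge_adjacent p q}\<^sup>*)"

text \<open>
  For \<open>mu \<le> lam\<close> all exponents are nonnegative. In the second one the positive terms are collected
  first, because \<open>|\<lambda>| - |\<mu>| - r - c\<close> alone can be negative.
\<close>

definition dual_groth_skew1 ::
  "'a::comm_ring_1 \<Rightarrow> 'a \<Rightarrow> (nat \<Rightarrow> nat) \<Rightarrow> (nat \<Rightarrow> nat) \<Rightarrow> 'a \<Rightarrow> 'a" where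
  "dual_groth_skew1 \<alpha> \<beta> lam mu x =
     (let S = skew_diagram lam mu; r = num_rows S; c = num_cols S; b = num_components S in
      \<beta> ^ (r - b) * (\<alpha> + \<beta>) ^ ((partition_size lam + b) - (partition_size mu + r + c))
        * x ^ b * (\<alpha> + x) ^ (c - b))"

fun dual_groth ::
  "'a::comm_ring_1 \<Rightarrow> 'a \<Rightarrow> (nat \<Rightarrow> 'a) \<Rightarrow> nat \<Rightarrow> (nat \<Rightarrow> nat) \<Rightarrow> 'a" where
  "dual_groth \<alpha> \<beta> x 0 lam = (if lam = (\<lambda>_. 0) then 1 else 0)"
| "dual_groth \<alpha> \<beta> x (Suc n) lam =
     (\<Sum>mu | is_partition mu \<and> mu \<le> lam.
        dual_groth \<alpha> \<beta> x n mu * dual_groth_skew1 \<alpha> \<beta> lam mu (x n))"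

definition conj_mult :: "(nat \<Rightarrow> nat) \<Rightarrow> nat \<Rightarrow> nat" where
  "conj_mult lam j = lam j - lam (Suc j)"

text \<open>
  A labeling is a pair \<open>(h, v)\<close>: in row \<open>k\<close> the vertex at site \<open>j\<close> has left label \<open>h k j\<close>, bottom
  label \<open>v k j\<close>, right label \<open>h k (Suc j)\<close> and top label \<open>v (Suc k) j\<close>. Entries of \<open>h\<close> and \<open>v\<close> that
  do not belong to an edge of the \<open>n\<close>-row lattice are set to 0, so that each labeling is represented
  exactly once. The right, bottom and top boundary values are \<open>rb\<close>, \<open>bb\<close> and \<open>tb\<close>.
\<close>

definition labelings ::
  "nat \<Rightarrow> nat \<Rightarrow> (nat \<Rightarrow> nat) \<Rightarrow> (nat \<Rightarrow> nat) \<Rightarrow> ((nat \<Rightarrow> nat \<Rightarrow> nat) \<times> (nat \<Rightarrow> nat \<Rightarrow> nat)) set" where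
  "labelings n rb bb tb =
     {(h, v). (\<forall>k<n. \<exists>J. \<forall>j\<ge>J. h k (Suc j) = rb) \<and> v 0 = bb \<and> v n = tb \<and>
              (\<forall>k\<ge>n. \<forall>j. h k j = 0) \<and> (\<forall>k>n. \<forall>j. v k j = 0)}"

text \<open>
  The product over all sites of a row: it vanishes as soon as one factor does (there may be
  infinitely many vanishing factors), and otherwise only finitely many factors differ from 1.
\<close>

definition site_prod :: "(nat \<Rightarrow> 'a::comm_ring_1) \<Rightarrow> 'a" where
  "site_prod f = (if \<exists>j. f j = 0 then 0 else \<Prod>j | f j \<noteq> 1. f j)"

definition labeling_weight ::
  "('a \<Rightarrow> nat \<Rightarrow> nat \<Rightarrow> nat \<Rightarrow> nat \<Rightarrow> 'a) \<Rightarrow> (nat \<Rightarrow> 'a) \<Rightarrow> nat \<Rightarrow>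
   (nat \<Rightarrow> nat \<Rightarrow> nat) \<times> (nat \<Rightarrow> nat \<Rightarrow> nat) \<Rightarrow> 'a::comm_ring_1" where
  "labeling_weight w x n = (\<lambda>(h, v).
     \<Prod>k<n. site_prod (\<lambda>j. w (x k) (h k j) (v k j) (h k (Suc j)) (v (Suc k) j)))"

text \<open>
  The set of all labelings is infinite, so the sum is taken over those of nonzero weight. In the
  model below there are only finitely many: \<open>a + b = c + d\<close> at every vertex bounds
  \<open>\<Sum>i\<ge>j. v k i\<close>, for every \<open>k \<le> n\<close>, by the same sum over the top boundary, and the horizontal labels
  are differences of such sums.
\<close>

definition partition_function ::
  "('a \<Rightarrow> nat \<Rightarrow> nat \<Rightarrow> nat \<Rightarrow> nat \<Rightarrow> 'a) \<Rightarrow> (nat \<Rightarrow> 'a) \<Rightarrow> nat \<Rightarrow>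
   nat \<Rightarrow> (nat \<Rightarrow> nat) \<Rightarrow> (nat \<Rightarrow> nat) \<Rightarrow> 'a::comm_ring_1" where
  "partition_function w x n rb bb tb =
     (\<Sum>s | s \<in> labelings n rb bb tb \<and> labeling_weight w x n s \<noteq> 0. labeling_weight w x n s)"

definition vertex_weight ::
  "'a::comm_ring_1 \<Rightarrow> 'a \<Rightarrow> 'a \<Rightarrow> nat \<Rightarrow> nat \<Rightarrow> nat \<Rightarrow> nat \<Rightarrow> 'a" where
  "vertex_weight \<alpha> \<beta> x a b c d =
     (if a + b = c + d then
        if a = 0 then 1
        else if d < a then \<beta> * (\<alpha> + \<beta>) ^ (a - d - 1) * (x + \<alpha>) ^ d
        else x * (x + \<alpha>) ^ (a - 1)
      else 0)"

end

theory Submission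
  imports Defs
begin

text \<open>
  Conservation \<open>a + b = c + d\<close> together with the right boundary value 0 forces the horizontal labels
  between the vertical labels of \<open>\<mu>\<close> and \<open>\<lambda>\<close> to be \<open>\<lambda>\<^sub>j - \<mu>\<^sub>j\<close>, so an admissible labeling is the same as a
  chain of partitions, and it suffices to compare the weight of one row with the one-variable skew
  polynomial. At site \<open>j\<close> the label \<open>a\<close> is the length of row \<open>j\<close> of \<open>\<lambda>/\<mu>\<close>. If \<open>a > d\<close>, that row shares
  \<open>a - d\<close> columns with the next one and \<open>d\<close> of its columns end there; if \<open>0 < a \<le> d\<close>, it is the last
  row of its connected component and all of its \<open>a\<close> columns end there. Hence components correspond
  to sites with \<open>0 < a \<le> d\<close> and the number of columns is the sum of \<open>min a d\<close>.
\<close>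

section \<open>Statistics of skew diagrams\<close>

lemma is_partition_bound:
  assumes "is_partition lam"
  obtains N where "\<And>i. N \<le> i \<Longrightarrow> lam i = 0"
proof -
  have "finite {i. lam i \<noteq> 0}" using assms by (simp add: is_partition_def)
  then obtain N where "\<forall>i\<in>{i. lam i \<noteq> 0}. i < N"
    using finite_nat_set_iff_bounded by blast
  then show ?thesis using that by (metis (mono_tags) mem_Collect_eq not_le)
qed

lemma is_partitionI:
  assumes "\<And>i. lam (Suc i) \<le> lam i" and "\<And>i. N \<le> i \<Longrightarrow> lam i = 0"
  shows "is_partition lam"
proof -
  have "{i. lam i \<noteq> 0} \<subseteq> {..<N}" using assms(2) by (metis (mono_tags) lessThan_iff mem_Collect_eq not_le subsetI)
  then show ?thesis
    using assms(1) by (auto simp: is_partition_def antimono_iff_le_Suc intro: finite_subset)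
qed

lemma partition_antimono: "is_partition lam \<Longrightarrow> i \<le> j \<Longrightarrow> lam j \<le> lam i"
  by (simp add: is_partition_def antimonoD)

lemma partition_size_eq:
  assumes "\<And>i. N \<le> i \<Longrightarrow> lam i = 0"
  shows "partition_size lam = (\<Sum>i<N. lam i)"
proof -
  have "{i. lam i \<noteq> 0} \<subseteq> {..<N}" using assms by (metis (mono_tags) lessThan_iff mem_Collect_eq not_le subsetI)
  then show ?thesis unfolding partition_size_def by (intro sum.mono_neutral_left) auto
qed

lemma num_rows_skew_diagram: "num_rows (skew_diagram lam mu) = card {i. mu i < lam i}"
proof -
  have "fst ` skew_diagram lam mu = {i. mu i < lam i}"
    by (force simp: skew_diagram_def image_iff)
  then show ?thesis by (simp add: num_rows_def)
qed

text \<open>Each column is counted at its last row.\<close>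

lemma num_cols_skew_diagram:
  assumes lam: "is_partition lam" and mu: "is_partition mu" and N: "\<And>i. N \<le> i \<Longrightarrow> lam i = 0"
  shows "num_cols (skew_diagram lam mu) = (\<Sum>i<N. lam i - max (mu i) (lam (Suc i)))"
proof -
  \<comment> \<open>\<open>I i\<close> collects the columns whose lowest box is in row
    \<open>i\<close>: since \<open>mu (Suc i) \<le> mu i\<close>, a column \<open>j\<close> of row
    \<open>i\<close> continues in the next row exactly if \<open>j < lam (Suc i)\<close>.\<close>
  define I where "I i = {max (mu i) (lam (Suc i))..<lam i}" for i
  have "snd ` skew_diagram lam mu = (\<Union>i<N. I i)"
  proof
    show "(\<Union>i<N. I i) \<subseteq> snd ` skew_diagram lam mu"
      by (force simp: I_def skew_diagram_def image_iff)
    show "snd ` skew_diagram lam mu \<subseteq> (\<Union>i<N. I i)"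
    proof
      fix j assume "j \<in> snd ` skew_diagram lam mu"
      then obtain i where i: "mu i \<le> j" "j < lam i" by (auto simp: skew_diagram_def)
      define P where "P k \<longleftrightarrow> mu k \<le> j \<and> j < lam k" for k
      have bd: "\<forall>k. P k \<longrightarrow> k \<le> N"
        by (metis P_def N nat_le_linear not_less_zero)
      have Pi: "P i" using i by (simp add: P_def)
      define k where "k = (GREATEST k. P k)"
      have k: "P k" unfolding k_def using GreatestI_nat[of P, OF Pi] bd by blast
      have "\<not> P (Suc k)"
        unfolding k_def using Greatest_le_nat[of P "Suc (GREATEST k. P k)" N] bd by auto
      moreover have "mu (Suc k) \<le> mu k" using mu by (simp add: partition_antimono)
      ultimately have "j \<in> I k" using k by (auto simp: P_def I_def)
      moreover have "k < N" using k N by (metis P_def not_le not_less_zero)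
      ultimately show "j \<in> (\<Union>i<N. I i)" by blast
    qed
  qed
  \<comment> \<open>A later interval \<open>I j\<close> ends at
    \<open>lam j \<le> lam (Suc i)\<close>, and \<open>I i\<close> starts no earlier than
    \<open>lam (Suc i)\<close>.\<close>
  moreover have "I i \<inter> I j = {}" if "i < j" for i j
    using partition_antimono[OF lam, of "Suc i" j] that by (auto simp: I_def)
  then have "I i \<inter> I j = {}" if "i \<noteq> j" for i j
    using that by (metis Int_commute nat_neq_iff)
  then have "card (\<Union>i<N. I i) = (\<Sum>i<N. card (I i))"
    by (intro card_UN_disjoint) (auto simp: I_def)
  ultimately show ?thesis by (simp add: num_cols_def I_def)
qed

section \<open>Connected components of a skew diagram\<close>

text \<open>A complete invariant \<open>f\<close> of the classes induces a well-defined injective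
  map on the quotient. This allows components to be counted by an explicit invariant.\<close>

lemma card_quotient_eq_card_image:
  assumes "\<And>p q. p \<in> S \<Longrightarrow> q \<in> S \<Longrightarrow> r `` {p} = r `` {q} \<longleftrightarrow> f p = f q"
  shows "card (S // r) = card (f ` S)"
proof -
  have S: "S // r = (\<lambda>p. r `` {p}) ` S" by (auto simp: quotient_def)
  define g where "g C = f (SOME p. p \<in> S \<and> r `` {p} = C)" for C
  have g: "g (r `` {p}) = f p" if "p \<in> S" for p
  proof -
    have "\<exists>q. q \<in> S \<and> r `` {q} = r `` {p}" using that by blast
    then have "(SOME q. q \<in> S \<and> r `` {q} = r `` {p}) \<in> S \<and>
        r `` {SOME q. q \<in> S \<and> r `` {q} = r `` {p}} = r `` {p}" by (rule someI_ex)
    then show ?thesis unfolding g_def using assms that by blast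
  qed
  have "inj_on g (S // r)"
  proof (rule inj_onI)
    fix C D assume "C \<in> S // r" "D \<in> S // r" and eq: "g C = g D"
    then obtain p q where "p \<in> S" "q \<in> S" "C = r `` {p}" "D = r `` {q}" unfolding S by blast
    then show "C = D" using eq g assms[of p q] by metis
  qed
  moreover have "g ` (S // r) = f ` S" unfolding S image_image using g by auto
  ultimately show ?thesis by (metis card_image)
qed

text \<open>Consecutive nonempty rows \<open>i\<close> and \<open>Suc i\<close> share a column
  exactly if \<open>mu i < lam (Suc i)\<close>. Hence a component is a maximal run of overlapping
  rows, and it is represented by its last row.\<close>

lemma num_components_skew_diagram:
  assumes lam: "is_partition lam" and mu: "is_partition mu"
  shows "num_components (skew_diagram lam mu) = card {i. mu i < lam i \<and> lam (Suc i) \<le> mu i}"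
proof -
  obtain N where N: "\<And>i. N \<le> i \<Longrightarrow> lam i = 0" using is_partition_bound[OF lam] by blast
  define S where "S = skew_diagram lam mu"
  define R where "R = {(p, q). p \<in> S \<and> q \<in> S \<and> edge_adjacent p q}"
  define E where "E = {i. mu i < lam i \<and> lam (Suc i) \<le> mu i}"
  \<comment> \<open>For a nonempty row \<open>i\<close> this is the last row of its component. If
    \<open>E\<close> has no element from \<open>i\<close> on, the value is unspecified, but
    \<open>last_step\<close> still holds because it compares equal predicates.\<close>
  define last where "last i = (LEAST k. i \<le> k \<and> k \<in> E)" for i
  have S: "(i, j) \<in> S \<longleftrightarrow> mu i \<le> j \<and> j < lam i" for i j
    by (simp add: S_def skew_diagram_def)
  have "sym R" by (auto simp: R_def sym_def edge_adjacent_def)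
  then have symR: "sym (R\<^sup>*)" by (rule sym_rtrancl)
  have last_E: "last i = i" if "i \<in> E" for i
    unfolding last_def by (rule Least_equality) (use that in auto)
  have last_step: "last (Suc i) = last i" if "i \<notin> E" for i
  proof -
    have "(\<lambda>k. Suc i \<le> k \<and> k \<in> E) = (\<lambda>k. i \<le> k \<and> k \<in> E)"
      using that by (metis Suc_leD le_neq_implies_less less_eq_Suc_le)
    then show ?thesis by (simp add: last_def)
  qed
  have left: "((i, j), (i, mu i)) \<in> R\<^sup>*" if "(i, j) \<in> S" for i j
    using that
  proof (induction j)
    case 0
    then show ?case by (simp add: S)
  next
    case (Suc j)
    show ?case
    proof (cases "mu i = Suc j")
      case False
      then have ij: "(i, j) \<in> S" using Suc.prems by (auto simp: S)
      then have "((i, Suc j), (i, j)) \<in> R"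
        using Suc.prems by (simp add: R_def edge_adjacent_def)
      then show ?thesis using Suc.IH[OF ij] by (rule converse_rtrancl_into_rtrancl)
    qed simp
  qed
  \<comment> \<open>The leftmost box of the last row is the canonical box of a component. To reach
    it, walk left to the end of the row and then, if \<open>i\<close> is not in \<open>E\<close>,
    one step down: \<open>mu (Suc i) \<le> mu i < lam (Suc i)\<close> keeps the path in
    \<open>S\<close>.\<close>
  have to_last: "last i \<in> E \<and> ((i, j), (last i, mu (last i))) \<in> R\<^sup>*" if "(i, j) \<in> S" for i j
    using that
  proof (induction "N - i" arbitrary: i j rule: less_induct)
    case less
    have ij: "mu i \<le> j" "j < lam i" using less.prems by (auto simp: S)
    show ?case
    proof (cases "i \<in> E")
      case True
      then show ?thesis using left[OF less.prems] last_E by simp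
    next
      case False
      have "i < N" using N[of i] ij by (metis not_le not_less_zero)
      have "mu (Suc i) \<le> mu i" using mu by (simp add: partition_antimono)
      then have below: "(Suc i, mu i) \<in> S" using False ij by (auto simp: E_def S)
      have corner: "(i, mu i) \<in> S" using ij by (auto simp: S)
      have "((i, mu i), (Suc i, mu i)) \<in> R"
        using below corner by (simp add: R_def edge_adjacent_def)
      then have "((i, j), (Suc i, mu i)) \<in> R\<^sup>*"
        using left[OF less.prems] by (rule rtrancl_into_rtrancl[rotated])
      moreover have "N - Suc i < N - i" using \<open>i < N\<close> by simp
      ultimately show ?thesis
        using less.hyps[OF _ below] last_step[OF False] by (auto intro: rtrancl_trans)
    qed
  qed
  \<comment> \<open>A column \<open>j\<close> shared by both rows gives
    \<open>mu i \<le> j < lam (Suc i)\<close>, so \<open>i\<close> is not in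
    \<open>E\<close>.\<close>
  have inv_down: "last (Suc i) = last i" if "(i, j) \<in> S" "(Suc i, j) \<in> S" for i j
    by (rule last_step) (use that in \<open>auto simp: E_def S\<close>)
  have inv1: "last (fst p) = last (fst q)" if "(p, q) \<in> R" for p q
    using that inv_down by (cases p; cases q) (auto simp: R_def edge_adjacent_def)
  have inv: "last (fst p) = last (fst q)" if "(p, q) \<in> R\<^sup>*" for p q
    using that by (induction rule: rtrancl_induct) (use inv1 in auto)
  have "card (S // R\<^sup>*) = card ((\<lambda>p. last (fst p)) ` S)"
  proof (rule card_quotient_eq_card_image)
    fix p q assume p: "p \<in> S" and q: "q \<in> S"
    show "R\<^sup>* `` {p} = R\<^sup>* `` {q} \<longleftrightarrow> last (fst p) = last (fst q)"
    proof
      assume "R\<^sup>* `` {p} = R\<^sup>* `` {q}"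
      then show "last (fst p) = last (fst q)" using inv by blast
    next
      assume eq: "last (fst p) = last (fst q)"
      define c where "c = (last (fst p), mu (last (fst p)))"
      have "(p, c) \<in> R\<^sup>*" "(q, c) \<in> R\<^sup>*"
        using to_last[of "fst p" "snd p"] to_last[of "fst q" "snd q"] p q eq by (auto simp: c_def)
      then have "(p, q) \<in> R\<^sup>*" "(q, p) \<in> R\<^sup>*"
        using symR by (meson rtrancl_trans symD)+
      then show "R\<^sup>* `` {p} = R\<^sup>* `` {q}" by (auto intro: rtrancl_trans)
    qed
  qed
  moreover have "(\<lambda>p. last (fst p)) ` S = E"
  proof
    show "(\<lambda>p. last (fst p)) ` S \<subseteq> E" using to_last by auto
    show "E \<subseteq> (\<lambda>p. last (fst p)) ` S"
    proof
      fix i assume i: "i \<in> E"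
      then have "(i, mu i) \<in> S" by (auto simp: E_def S)
      then show "i \<in> (\<lambda>p. last (fst p)) ` S" using last_E[OF i] by (force simp: image_iff)
    qed
  qed
  ultimately show ?thesis by (simp add: num_components_def S_def R_def E_def)
qed

section \<open>The weight of a single row\<close>

lemma site_prod_eq_prod:
  assumes "\<And>j. N \<le> j \<Longrightarrow> f j = 1"
  shows "site_prod f = (\<Prod>j<N. f j)"
proof (cases "\<exists>j. f j = 0")
  case True
  then obtain j where j: "f j = 0" by blast
  then have "j < N" using assms[of j] by (metis not_le zero_neq_one)
  then have "(\<Prod>j<N. f j) = 0" using j by (intro prod_zero) auto
  then show ?thesis using True by (simp add: site_prod_def)
next
  case False
  have "{j. f j \<noteq> 1} \<subseteq> {..<N}" using assms by (metis (mono_tags) lessThan_iff mem_Collect_eq not_le subsetI)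
  then have "(\<Prod>j | f j \<noteq> 1. f j) = (\<Prod>j<N. f j)" by (intro prod.mono_neutral_left) auto
  then show ?thesis using False by (simp add: site_prod_def)
qed

text \<open>Both sides are products of powers of \<open>\<beta>\<close>,
  \<open>\<alpha> + \<beta>\<close>, \<open>x\<close> and \<open>x + \<alpha>\<close>, so it
  suffices to express the four exponents through the row lengths \<open>a\<close> and the top labels
  \<open>d\<close>.\<close>

lemma site_prod_row_eq_dual_groth_skew1:
  fixes \<alpha> \<beta> x :: "'a::comm_ring_1"
  assumes lam: "is_partition lam" and mu: "is_partition mu" and le: "mu \<le> lam"
  shows "site_prod (\<lambda>j. vertex_weight \<alpha> \<beta> x (lam j - mu j) (conj_mult mu j)
           (lam (Suc j) - mu (Suc j)) (conj_mult lam j)) = dual_groth_skew1 \<alpha> \<beta> lam mu x"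
proof -
  obtain N where N: "\<And>i. N \<le> i \<Longrightarrow> lam i = 0" using is_partition_bound[OF lam] by blast
  have le: "mu i \<le> lam i" for i using le by (simp add: le_fun_def)
  have N': "mu i = 0" if "N \<le> i" for i using N[OF that] le[of i] by simp
  have dl: "lam (Suc i) \<le> lam i" and dm: "mu (Suc i) \<le> mu i" for i
    using lam mu by (simp_all add: partition_antimono)
  define a where "a i = lam i - mu i" for i
  define d where "d i = lam i - lam (Suc i)" for i
  \<comment> \<open>\<open>A\<close> holds the rows that overlap the next one, since
    \<open>d i < a i\<close> means \<open>mu i < lam (Suc i)\<close>; \<open>E\<close> holds the
    last rows of components. All other rows are empty.\<close>
  define A where "A = {i. d i < a i}"
  define E where "E = {i. 0 < a i \<and> a i \<le> d i}"
  have aN: "a i = 0" if "N \<le> i" for i using that N by (simp add: a_def)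
  have AN: "A \<subseteq> {..<N}" and EN: "E \<subseteq> {..<N}"
    using aN by (auto simp: A_def E_def) (metis not_le not_less_zero)+
  then have fin: "finite A" "finite E" by (auto intro: finite_subset)
  have disj: "A \<inter> E = {}" by (auto simp: A_def E_def)
  have out: "a i = 0" if "i \<notin> A \<union> E" for i using that by (auto simp: A_def E_def)
  have "{i. mu i < lam i} = A \<union> E" by (auto simp: A_def E_def a_def)
  then have r: "num_rows (skew_diagram lam mu) = card A + card E"
    using fin disj by (simp add: num_rows_skew_diagram card_Un_disjoint)
  have "{i. mu i < lam i \<and> lam (Suc i) \<le> mu i} = E"
    using dl le by (auto simp: E_def a_def d_def)
  then have b: "num_components (skew_diagram lam mu) = card E"
    using lam mu by (simp add: num_components_skew_diagram)
  have "num_cols (skew_diagram lam mu) = (\<Sum>i<N. lam i - max (mu i) (lam (Suc i)))"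
    using lam mu N by (rule num_cols_skew_diagram)
  also have "\<dots> = (\<Sum>i<N. min (a i) (d i))"
    by (rule sum.cong) (use le dl in \<open>auto simp: a_def d_def min_def max_def\<close>)
  also have "\<dots> = (\<Sum>i\<in>A \<union> E. min (a i) (d i))"
    by (rule sum.mono_neutral_right) (use AN EN out in auto)
  also have "\<dots> = (\<Sum>i\<in>A. min (a i) (d i)) + (\<Sum>i\<in>E. min (a i) (d i))"
    using fin disj by (rule sum.union_disjoint)
  also have "(\<Sum>i\<in>A. min (a i) (d i)) = sum d A" by (rule sum.cong) (auto simp: A_def)
  \<comment> \<open>The summand 1 is split off because a site in \<open>E\<close> contributes one
    factor \<open>x\<close> and \<open>a i - 1\<close> factors \<open>x + \<alpha>\<close>; the
    subtraction is exact as \<open>0 < a i\<close> there.\<close>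
  also have "(\<Sum>i\<in>E. min (a i) (d i)) = (\<Sum>i\<in>E. (a i - 1) + 1)"
    by (rule sum.cong) (auto simp: E_def)
  also have "\<dots> = (\<Sum>i\<in>E. a i - 1) + card E" by (simp only: sum.distrib) simp
  finally have c: "num_cols (skew_diagram lam mu) = sum d A + ((\<Sum>i\<in>E. a i - 1) + card E)" .
  have "partition_size lam = (\<Sum>i<N. lam i)" using N by (rule partition_size_eq)
  also have "\<dots> = (\<Sum>i<N. mu i + a i)"
    by (rule sum.cong) (use le in \<open>auto simp: a_def\<close>)
  also have "\<dots> = partition_size mu + (\<Sum>i<N. a i)"
    using partition_size_eq[of N mu] N' by (simp add: sum.distrib)
  also have "(\<Sum>i<N. a i) = sum a (A \<union> E)"
    by (rule sum.mono_neutral_right) (use AN EN out in auto)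
  also have "\<dots> = sum a A + sum a E" using fin disj by (rule sum.union_disjoint)
  \<comment> \<open>This splits each overlapping row into the exponents of
    \<open>\<alpha> + \<beta>\<close>, \<open>x + \<alpha>\<close> and \<open>\<beta>\<close> at its
    site; it is exact because \<open>d i < a i\<close>.\<close>
  also have "sum a A = (\<Sum>i\<in>A. (a i - d i - 1) + d i + 1)" by (rule sum.cong) (auto simp: A_def)
  also have "\<dots> = (\<Sum>i\<in>A. a i - d i - 1) + sum d A + card A" by (simp only: sum.distrib) simp
  also have "sum a E = (\<Sum>i\<in>E. (a i - 1) + 1)" by (rule sum.cong) (auto simp: E_def)
  also have "\<dots> = (\<Sum>i\<in>E. a i - 1) + card E" by (simp only: sum.distrib) simp
  finally have size: "partition_size lam = partition_size mu +
    ((\<Sum>i\<in>A. a i - d i - 1) + sum d A + card A + ((\<Sum>i\<in>E. a i - 1) + card E))" .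
  define f where "f j = vertex_weight \<alpha> \<beta> x (lam j - mu j) (conj_mult mu j)
           (lam (Suc j) - mu (Suc j)) (conj_mult lam j)" for j
  \<comment> \<open>Conservation holds at every site, both sides being
    \<open>lam j - mu (Suc j)\<close>, so the zero branch of \<open>vertex_weight\<close> does not
    occur.\<close>
  have f: "f j = (if a j = 0 then 1 else if d j < a j then
      \<beta> * (\<alpha> + \<beta>) ^ (a j - d j - 1) * (x + \<alpha>) ^ d j else x * (x + \<alpha>) ^ (a j - 1))" for j
    using le[of j] le[of "Suc j"] dl[of j] dm[of j]
    by (simp add: f_def vertex_weight_def conj_mult_def a_def d_def)
  have "site_prod f = (\<Prod>j<N. f j)" by (rule site_prod_eq_prod) (simp add: f aN)
  also have "\<dots> = prod f (A \<union> E)"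
    by (rule prod.mono_neutral_right) (use AN EN out f in auto)
  also have "\<dots> = prod f A * prod f E" using fin disj by (rule prod.union_disjoint)
  also have "prod f A = (\<Prod>i\<in>A. \<beta> * (\<alpha> + \<beta>) ^ (a i - d i - 1) * (x + \<alpha>) ^ d i)"
    by (rule prod.cong) (auto simp: f A_def)
  also have "\<dots> = \<beta> ^ card A * (\<alpha> + \<beta>) ^ (\<Sum>i\<in>A. a i - d i - 1) * (x + \<alpha>) ^ sum d A"
    by (simp add: prod.distrib power_sum)
  also have "prod f E = (\<Prod>i\<in>E. x * (x + \<alpha>) ^ (a i - 1))"
    by (rule prod.cong) (auto simp: f E_def)
  also have "\<dots> = x ^ card E * (x + \<alpha>) ^ (\<Sum>i\<in>E. a i - 1)"
    by (simp add: prod.distrib power_sum)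
  finally have "site_prod f = \<beta> ^ card A * (\<alpha> + \<beta>) ^ (\<Sum>i\<in>A. a i - d i - 1) *
      x ^ card E * (\<alpha> + x) ^ (sum d A + (\<Sum>i\<in>E. a i - 1))"
    by (simp add: power_add algebra_simps)
  \<comment> \<open>By \<open>size\<close> everything else cancels, so the truncated subtraction is
    exact.\<close>
  moreover have "partition_size lam + card E -
      (partition_size mu + (card A + card E) + (sum d A + ((\<Sum>i\<in>E. a i - 1) + card E)))
      = (\<Sum>i\<in>A. a i - d i - 1)" using size by linarith
  ultimately show ?thesis
    by (simp add: dual_groth_skew1_def Let_def r b c f_def[abs_def])
qed

section \<open>Labelings as chains of partitions\<close>

text \<open>Vanishing differences make \<open>lam\<close> constant, and finite support makes the
  constant 0. This decides when a lattice without rows admits a labeling.\<close>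

lemma conj_mult_eq_zero_iff:
  assumes "is_partition lam"
  shows "conj_mult lam = (\<lambda>_. 0) \<longleftrightarrow> lam = (\<lambda>_. 0)"
proof
  assume eq: "conj_mult lam = (\<lambda>_. 0)"
  have "lam (Suc i) = lam i" for i
    using fun_cong[OF eq, of i] partition_antimono[OF assms, of i "Suc i"]
    by (simp add: conj_mult_def)
  then have const: "lam i = lam 0" for i by (induction i) auto
  obtain N where "\<And>i. N \<le> i \<Longrightarrow> lam i = 0" using is_partition_bound[OF assms] by blast
  then have "lam 0 = 0" using const[of N] by simp
  then show "lam = (\<lambda>_. 0)" using const by auto
qed (simp add: conj_mult_def fun_eq_iff)

lemma finite_partitions_le:
  assumes "is_partition lam"
  shows "finite {mu. is_partition mu \<and> mu \<le> lam}"
proof -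
  obtain N where N: "\<And>i. N \<le> i \<Longrightarrow> lam i = 0" using is_partition_bound[OF assms] by blast
  have "{mu. is_partition mu \<and> mu \<le> lam} \<subseteq>
      {mu. \<forall>i. (i \<in> {..<N} \<longrightarrow> mu i \<in> {..lam 0}) \<and> (i \<notin> {..<N} \<longrightarrow> mu i = 0)}"
  proof
    fix mu assume "mu \<in> {mu. is_partition mu \<and> mu \<le> lam}"
    then have mu: "mu i \<le> lam i" for i by (simp add: le_fun_def)
    have "mu i \<le> lam 0" for i using mu[of i] partition_antimono[OF assms, of 0 i] by simp
    moreover have "mu i = 0" if "i \<notin> {..<N}" for i using mu[of i] N[of i] that by simp
    ultimately show "mu \<in> {mu. \<forall>i. (i \<in> {..<N} \<longrightarrow> mu i \<in> {..lam 0}) \<and> (i \<notin> {..<N} \<longrightarrow> mu i = 0)}"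
      by simp
  qed
  then show ?thesis by (rule finite_subset) (intro finite_set_of_finite_funs; simp)
qed

text \<open>An index set that does not depend on the parameters: it contains every labeling of
  nonzero weight, and possibly others whose weight vanishes for special parameter values.\<close>

definition conserving_labelings ::
  "nat \<Rightarrow> (nat \<Rightarrow> nat) \<Rightarrow> ((nat \<Rightarrow> nat \<Rightarrow> nat) \<times> (nat \<Rightarrow> nat \<Rightarrow> nat)) set" where
  "conserving_labelings n lam = {(h, v). (h, v) \<in> labelings n 0 (\<lambda>_. 0) (conj_mult lam) \<and>
     (\<forall>k<n. \<forall>j. h k j + v k j = h k (Suc j) + v (Suc k) j)}"

text \<open>Puts row \<open>n\<close> on top of a labeling with top boundary
  \<open>conj_mult mu\<close>. The overwritten entries \<open>h n\<close> and
  \<open>v (Suc n)\<close> are the padding zeros of an \<open>n\<close>-row labeling.\<close>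

definition add_row ::
  "nat \<Rightarrow> (nat \<Rightarrow> nat) \<Rightarrow> (nat \<Rightarrow> nat) \<times> (nat \<Rightarrow> nat \<Rightarrow> nat) \<times> (nat \<Rightarrow> nat \<Rightarrow> nat) \<Rightarrow>
   (nat \<Rightarrow> nat \<Rightarrow> nat) \<times> (nat \<Rightarrow> nat \<Rightarrow> nat)" where
  "add_row n lam = (\<lambda>(mu, h, v). (h(n := (\<lambda>j. lam j - mu j)), v(Suc n := conj_mult lam)))"

text \<open>With \<open>mu j = lam j - g j\<close>, conservation reads
  \<open>mu j = mu (Suc j) + u j\<close>. Nonnegativity of the labels \<open>u\<close> thus makes
  \<open>mu\<close> weakly decreasing.\<close>

lemma conserving_row_partition:
  assumes lam: "is_partition lam"
    and cons: "\<And>j. g j + u j = g (Suc j) + conj_mult lam j"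
    and zero: "\<And>j. J \<le> j \<Longrightarrow> g j = 0"
  obtains mu where "is_partition mu" "mu \<le> lam" "g = (\<lambda>j. lam j - mu j)" "u = conj_mult mu"
proof -
  obtain N where N: "\<And>i. N \<le> i \<Longrightarrow> lam i = 0" using is_partition_bound[OF lam] by blast
  define mu where "mu j = lam j - g j" for j
  have dl: "lam (Suc j) \<le> lam j" for j using lam by (simp add: partition_antimono)
  \<comment> \<open>Induction leftwards from \<open>J\<close>, where \<open>g\<close> vanishes,
    using \<open>g j \<le> g (Suc j) + (lam j - lam (Suc j))\<close>. The bound makes the
    subtraction in \<open>mu\<close> exact.\<close>
  have g: "g j \<le> lam j" for j
  proof (induction "J - j" arbitrary: j)
    case 0
    then show ?case using zero[of j] by simp
  next
    case (Suc m)
    then have "g (Suc j) \<le> lam (Suc j)" by simp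
    then show ?case using cons[of j] dl[of j] by (simp add: conj_mult_def)
  qed
  have step: "mu j = mu (Suc j) + u j" for j
    using cons[of j] dl[of j] g[of j] g[of "Suc j"] by (simp add: conj_mult_def mu_def)
  have "mu (Suc j) \<le> mu j" for j using step[of j] by simp
  then have "is_partition mu" by (rule is_partitionI[of _ N]) (simp add: mu_def N)
  moreover have "mu \<le> lam" by (simp add: mu_def le_fun_def)
  moreover have "g = (\<lambda>j. lam j - mu j)" using g by (auto simp: mu_def)
  moreover have "u j = conj_mult mu j" for j using step[of j] by (simp add: conj_mult_def)
  then have "u = conj_mult mu" by auto
  ultimately show ?thesis by (rule that)
qed

text \<open>The inverse reads \<open>mu\<close> off the horizontal labels of the top row and resets
  the entries of that row to the padding value 0.\<close>

lemma bij_betw_add_row: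
  assumes lam: "is_partition lam"
  shows "bij_betw (add_row n lam)
    (SIGMA mu:{mu. is_partition mu \<and> mu \<le> lam}. conserving_labelings n mu)
    (conserving_labelings (Suc n) lam)"
  (is "bij_betw ?F ?D ?C")
proof (rule bij_betw_imageI)
  obtain N where N: "\<And>i. N \<le> i \<Longrightarrow> lam i = 0" using is_partition_bound[OF lam] by blast
  show "inj_on ?F ?D"
  proof (rule inj_onI)
    fix p p' assume p: "p \<in> ?D" "p' \<in> ?D" and eq: "?F p = ?F p'"
    obtain mu h v mu' h' v' where pp: "p = (mu, h, v)" "p' = (mu', h', v')"
      by (metis prod_cases3)
    have le: "mu \<le> lam" "mu' \<le> lam"
      and s: "(h, v) \<in> conserving_labelings n mu" "(h', v') \<in> conserving_labelings n mu'"
      using p by (auto simp: pp)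
    have eqh: "h(n := (\<lambda>j. lam j - mu j)) = h'(n := (\<lambda>j. lam j - mu' j))"
      and eqv: "v(Suc n := conj_mult lam) = v'(Suc n := conj_mult lam)"
      using eq by (auto simp: add_row_def pp)
    \<comment> \<open>Subtraction from \<open>lam j\<close> is injective on values at most
      \<open>lam j\<close>, so row \<open>n\<close> determines the partition.\<close>
    have "mu j = mu' j" for j
      using fun_cong[OF fun_cong[OF eqh, of n], of j] le_funD[OF le(1), of j] le_funD[OF le(2), of j]
      by simp
    moreover have "h k = h' k" for k
    proof (cases "k = n")
      case True
      then show ?thesis using s by (auto simp: conserving_labelings_def labelings_def)
    next
      case False
      then show ?thesis using fun_cong[OF eqh, of k] by simp
    qed
    moreover have "v k = v' k" for k
    proof (cases "k = Suc n")
      case True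
      then show ?thesis using s by (auto simp: conserving_labelings_def labelings_def)
    next
      case False
      then show ?thesis using fun_cong[OF eqv, of k] by simp
    qed
    ultimately show "p = p'" by (auto simp: pp)
  qed
  show "?F ` ?D = ?C"
  proof (intro equalityI subsetI)
    fix s assume "s \<in> ?F ` ?D"
    then obtain mu h v where mu: "is_partition mu" and le: "mu \<le> lam"
      and hv: "(h, v) \<in> conserving_labelings n mu"
      and s: "s = (h(n := (\<lambda>j. lam j - mu j)), v(Suc n := conj_mult lam))"
      by (auto simp: add_row_def)
    have row: "lam j - mu j + conj_mult mu j = lam (Suc j) - mu (Suc j) + conj_mult lam j" for j
      using le_funD[OF le, of j] le_funD[OF le, of "Suc j"]
        partition_antimono[OF lam, of j "Suc j"] partition_antimono[OF mu, of j "Suc j"]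
      by (simp add: conj_mult_def)
    \<comment> \<open>The right boundary condition of the new row, with the vanishing of a truncated
      difference written as an inequality.\<close>
    have "\<exists>J. \<forall>j\<ge>J. lam (Suc j) \<le> mu (Suc j)" using N by (metis le0 le_SucI)
    then show "s \<in> ?C"
      using hv row by (auto simp: s conserving_labelings_def labelings_def less_Suc_eq)
  next
    fix s assume "s \<in> ?C"
    then obtain h v where s: "s = (h, v)" and hv: "(h, v) \<in> ?C" by (cases s) auto
    obtain J where J: "\<And>j. J \<le> j \<Longrightarrow> h n (Suc j) = 0"
      using hv by (fastforce simp: conserving_labelings_def labelings_def)
    \<comment> \<open>The boundary condition speaks of right labels \<open>h n (Suc j)\<close>,
      hence the shift by one.\<close>
    have zero: "h n j = 0" if "Suc J \<le> j" for j using J[of "j - 1"] that by simp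
    have cons: "h n j + v n j = h n (Suc j) + conj_mult lam j" for j
      using hv by (auto simp: conserving_labelings_def labelings_def)
    obtain mu where mu: "is_partition mu" "mu \<le> lam"
      and h: "h n = (\<lambda>j. lam j - mu j)" and v: "v n = conj_mult mu"
      using conserving_row_partition[OF lam cons zero] by metis
    have top: "v (Suc n) = conj_mult lam" using hv by (simp add: conserving_labelings_def labelings_def)
    have "(h(n := (\<lambda>_. 0)), v(Suc n := (\<lambda>_. 0))) \<in> conserving_labelings n mu"
      using hv v by (auto simp: conserving_labelings_def labelings_def)
    moreover have "s = ?F (mu, h(n := (\<lambda>_. 0)), v(Suc n := (\<lambda>_. 0)))"
      unfolding s add_row_def prod.case fun_upd_upd h[symmetric] top[symmetric] by simp
    ultimately show "s \<in> ?F ` ?D" using mu by blast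
  qed
qed

text \<open>Without rows, the bottom and top boundaries are the same edges \<open>v 0\<close>, so
  \<open>conj_mult lam\<close> must vanish; all other entries are padding.\<close>

lemma conserving_labelings_0:
  assumes "is_partition lam"
  shows "conserving_labelings 0 lam = (if lam = (\<lambda>_. 0) then {((\<lambda>_ _. 0), (\<lambda>_ _. 0))} else {})"
proof -
  have zero: "(\<forall>k\<ge>0. \<forall>j. h k j = 0) \<longleftrightarrow> h = (\<lambda>_ _. 0)" for h :: "nat \<Rightarrow> nat \<Rightarrow> nat"
    by (simp add: fun_eq_iff)
  have bottom: "v 0 = (\<lambda>_. 0) \<and> (\<forall>k>0. \<forall>j. v k j = 0) \<longleftrightarrow> v = (\<lambda>_ _. 0)"
    for v :: "nat \<Rightarrow> nat \<Rightarrow> nat"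
    unfolding fun_eq_iff by (metis gr0I)
  have "(h, v) \<in> conserving_labelings 0 lam \<longleftrightarrow>
      conj_mult lam = (\<lambda>_. 0) \<and> h = (\<lambda>_ _. 0) \<and> v = (\<lambda>_ _. 0)" for h v
    unfolding conserving_labelings_def labelings_def mem_Collect_eq prod.case zero bottom[symmetric]
    by auto
  then show ?thesis unfolding conj_mult_eq_zero_iff[OF assms] by auto
qed

lemma finite_conserving_labelings:
  assumes "is_partition lam"
  shows "finite (conserving_labelings n lam)"
  using assms
proof (induction n arbitrary: lam)
  case 0
  then show ?case by (simp add: conserving_labelings_0)
next
  case (Suc n)
  have "finite (SIGMA mu:{mu. is_partition mu \<and> mu \<le> lam}. conserving_labelings n mu)"
    using finite_partitions_le[OF Suc.prems] Suc.IH by (intro finite_SigmaI) auto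
  then show ?case using bij_betw_finite[OF bij_betw_add_row[OF Suc.prems]] by blast
qed

section \<open>Summation of the weights over chains of partitions\<close>

text \<open>The two updates leave the factors of the rows below \<open>n\<close> unchanged. The new
  factor is the weight of a row between \<open>conj_mult mu\<close> and
  \<open>conj_mult lam\<close>.\<close>

lemma labeling_weight_add_row:
  assumes lam: "is_partition lam" and mu: "is_partition mu" "mu \<le> lam"
    and s: "s \<in> conserving_labelings n mu"
  shows "labeling_weight (vertex_weight \<alpha> \<beta>) x (Suc n) (add_row n lam (mu, s)) =
    labeling_weight (vertex_weight \<alpha> \<beta>) x n s * dual_groth_skew1 \<alpha> \<beta> lam mu (x n)"
proof -
  obtain h v where hv: "s = (h, v)" by (cases s)
  have "v n = conj_mult mu" using s by (simp add: hv conserving_labelings_def labelings_def)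
  then show ?thesis
    by (simp add: hv add_row_def labeling_weight_def site_prod_row_eq_dual_groth_skew1[OF lam mu, symmetric])
qed

text \<open>Removing the top row turns the sum into a double sum over \<open>mu\<close> and the
  labelings below, from which the row weight factors out. This is the branching recursion of
  \<open>dual_groth\<close>; its start is the empty product.\<close>

lemma sum_conserving_labelings_eq_dual_groth:
  assumes "is_partition lam"
  shows "(\<Sum>s\<in>conserving_labelings n lam. labeling_weight (vertex_weight \<alpha> \<beta>) x n s) =
    dual_groth \<alpha> \<beta> x n lam"
  using assms
proof (induction n arbitrary: lam)
  case 0
  then show ?case by (simp add: conserving_labelings_0 labeling_weight_def)
next
  case (Suc n)
  let ?W = "labeling_weight (vertex_weight \<alpha> \<beta>) x"
  let ?P = "{mu. is_partition mu \<and> mu \<le> lam}"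
  have "sum (?W (Suc n)) (conserving_labelings (Suc n) lam) =
      (\<Sum>p\<in>(SIGMA mu:?P. conserving_labelings n mu). ?W (Suc n) (add_row n lam p))"
    using sum.reindex_bij_betw[OF bij_betw_add_row[OF Suc.prems], of "?W (Suc n)"] by simp
  also have "\<dots> = (\<Sum>mu\<in>?P. \<Sum>s\<in>conserving_labelings n mu. ?W (Suc n) (add_row n lam (mu, s)))"
    by (subst sum.Sigma)
      (auto simp: finite_partitions_le[OF Suc.prems] finite_conserving_labelings)
  also have "\<dots> = (\<Sum>mu\<in>?P. \<Sum>s\<in>conserving_labelings n mu.
      ?W n s * dual_groth_skew1 \<alpha> \<beta> lam mu (x n))"
    by (intro sum.cong refl) (auto simp: labeling_weight_add_row[OF Suc.prems])
  also have "\<dots> = (\<Sum>mu\<in>?P. dual_groth \<alpha> \<beta> x n mu * dual_groth_skew1 \<alpha> \<beta> lam mu (x n))"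
    by (rule sum.cong) (auto simp: sum_distrib_right[symmetric] Suc.IH)
  finally show ?case by simp
qed

text \<open>One vertex violating conservation has weight 0, which makes the product of its row, and
  with it the whole weight, vanish.\<close>

lemma conserving_if_labeling_weight_nonzero:
  assumes "(h, v) \<in> labelings n 0 (\<lambda>_. 0) (conj_mult lam)"
    and nz: "labeling_weight (vertex_weight \<alpha> \<beta>) x n (h, v) \<noteq> 0"
  shows "(h, v) \<in> conserving_labelings n lam"
proof -
  have "h k j + v k j = h k (Suc j) + v (Suc k) j" if "k < n" for k j
  proof (rule ccontr)
    assume "\<not> ?thesis"
    then have "vertex_weight \<alpha> \<beta> (x k) (h k j) (v k j) (h k (Suc j)) (v (Suc k) j) = 0"
      by (simp add: vertex_weight_def)
    then have "site_prod (\<lambda>j. vertex_weight \<alpha> \<beta> (x k) (h k j) (v k j) (h k (Suc j)) (v (Suc k) j)) = 0"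
      by (auto simp: site_prod_def)
    then have "labeling_weight (vertex_weight \<alpha> \<beta>) x n (h, v) = 0"
      unfolding labeling_weight_def prod.case using that by (intro prod_zero) auto
    then show False using nz by simp
  qed
  then show ?thesis using assms by (simp add: conserving_labelings_def)
qed

theorem theorem3p2:
  fixes \<alpha> \<beta> :: "'a::comm_ring_1" and x :: "nat \<Rightarrow> 'a" and n :: nat and lam :: "nat \<Rightarrow> nat"
  assumes "1 \<le> n" and "is_partition lam"
  shows "dual_groth \<alpha> \<beta> x n lam =
    partition_function (vertex_weight \<alpha> \<beta>) x n 0 (\<lambda>_. 0) (conj_mult lam)"
proof -
  \<comment> \<open>Passing to the finite set of conserving labelings only adds terms equal to
    0.\<close>
  have "partition_function (vertex_weight \<alpha> \<beta>) x n 0 (\<lambda>_. 0) (conj_mult lam) =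
      (\<Sum>s\<in>conserving_labelings n lam. labeling_weight (vertex_weight \<alpha> \<beta>) x n s)"
    unfolding partition_function_def
  proof (rule sum.mono_neutral_left[OF finite_conserving_labelings[OF assms(2)]])
    show "{s \<in> labelings n 0 (\<lambda>_. 0) (conj_mult lam).
        labeling_weight (vertex_weight \<alpha> \<beta>) x n s \<noteq> 0} \<subseteq> conserving_labelings n lam"
      using conserving_if_labeling_weight_nonzero by auto
  qed (auto simp: conserving_labelings_def)
  then show ?thesis using sum_conserving_labelings_eq_dual_groth[OF assms(2), of \<alpha> \<beta> x n] by simp
qed

end
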